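(* Let $n\in\mathbb{N}^*$ be fixed and let $a_k=(-1)^{T^k(n)}$ for $k\in\mathbb{N}=\{0,1,2,\dots\}$. Then: (1) The sequence $(a_k)_{k=0}^\infty$ is eventually periodic if and only if the trajectory $\{T^k(n)\}_{k=0}^\infty$ reaches a cycle. (2) The sequence $(a_k)_{k=0}^\infty$ is eventually periodic with period $2$ if and only if the trajectory $\{T^k(n)\}_{k=0}^\infty$ reaches the trivial cycle $\{1,2\}$. (3) The sequence $(a_k)_{k=0}^\infty$ is not eventually periodic if and only if the trajectory $\{T^k(n)\}_{k=0}^\infty$ diverges to infinity.
   Context: $\mathbb{N}^*=\{1,2,3,\dots\}$. The Collatz map $T\colon\mathbb{N}^*\to\mathbb{N}^*$ is $T(n)=n/2$ for $n$ even and $T(n)=(3n+1)/2$ for $n$ odd; $T^0$ is the identity. A cycle is a finite set $\{n_1,\dots,n_k\}\subset\mathbb{N}^*$ of distinct elements with $T(n_i)=n_{i+1}$ for $i<k$ and $T(n_k)=n_1$. A sequence $(a_k)$ is eventually periodic with period $l\in\mathbb{N}^*$ if there is $k_0$ with $a_{k+l}=a_k$ for all $k\ge k_0$, and eventually periodic if this holds for some $l$. *)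

theory Defs
  imports Complex_Main
begin

text \<open>The map is meant on the positive naturals, which it preserves; at 0, where the
  formula gives 0, it is irrelevant.\<close>

definition collatz :: "nat \<Rightarrow> nat" where
  "collatz n = (if even n then n div 2 else (3 * n + 1) div 2)"

definition trajectory :: "nat \<Rightarrow> nat \<Rightarrow> nat" where
  "trajectory n k = (collatz ^^ k) n"

definition parity_seq :: "nat \<Rightarrow> nat \<Rightarrow> int" where
  "parity_seq n k = (- 1) ^ trajectory n k"

text \<open>The condition \<open>0 \<notin> C\<close> excludes the junk fixed point 0.\<close>

definition is_cycle :: "nat set \<Rightarrow> bool" where
  "is_cycle C \<longleftrightarrow> 0 \<notin> C \<and>
    (\<exists>ns. ns \<noteq> [] \<and> distinct ns \<and> set ns = C \<and>
      (\<forall>i. Suc i < length ns \<longrightarrow> collatz (ns ! i) = ns ! Suc i) \<and>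
      collatz (last ns) = hd ns)"

definition reaches :: "(nat \<Rightarrow> nat) \<Rightarrow> nat set \<Rightarrow> bool" where
  "reaches x C \<longleftrightarrow> (\<exists>k. x k \<in> C)"

definition eventually_periodic_with :: "nat \<Rightarrow> (nat \<Rightarrow> 'a) \<Rightarrow> bool" where
  "eventually_periodic_with l a \<longleftrightarrow> l \<ge> 1 \<and> (\<exists>k0. \<forall>k\<ge>k0. a (k + l) = a k)"

definition eventually_periodic :: "(nat \<Rightarrow> 'a) \<Rightarrow> bool" where
  "eventually_periodic a \<longleftrightarrow> (\<exists>l. eventually_periodic_with l a)"

lemma is_cycle_trivial: "is_cycle {1, 2}"
  unfolding is_cycle_def
  by (intro conjI exI[of _ "[1, 2]"]) (auto simp: collatz_def)

end

theory Submission
  imports Defs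
begin

text \<open>The parities of the first \<open>j\<close> terms of a trajectory determine its starting value modulo
  \<open>2 ^ j\<close> (\<open>parities_determine_start_mod\<close>). Hence the whole parity sequence determines the starting
  value: two numbers that are congruent modulo every power of two are equal. If the parities are
  periodic with period \<open>l\<close> from index \<open>k\<close> on, then the trajectories that start at the \<open>k\<close>-th and at
  the \<open>(k + l)\<close>-th term have the same parities, so these two terms coincide. Parity is thus
  eventually periodic with period \<open>l\<close> exactly when some term of the trajectory is fixed by the
  \<open>l\<close>-th iterate of the map (\<open>parity_eventually_periodic_with_iff\<close>).

  All three claims are readings of this equivalence. A positive number fixed by some iterate is
  the same as a member of a cycle; the positive numbers fixed by the second iterate are 1 and 2; and
  an orbit in the natural numbers that does not tend to infinity takes some value twice, by the
  pigeonhole principle, hence contains a point fixed by an iterate.\<close>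

section \<open>Orbits of self-maps of the natural numbers\<close>

lemma funpow_periodic_shift:
  assumes "(f ^^ l) ((f ^^ k) x) = (f ^^ k) x" "k \<le> m"
  shows "(f ^^ (m + l)) x = (f ^^ m) x"
proof -
  obtain d where d: "m = d + k" using assms(2) by (metis add.commute le_Suc_ex)
  have "m + l = d + (l + k)" using d by simp
  then have "(f ^^ (m + l)) x = (f ^^ d) ((f ^^ l) ((f ^^ k) x))" by (simp only: funpow_add comp_apply)
  also have "\<dots> = (f ^^ m) x" by (simp add: assms(1) d funpow_add)
  finally show ?thesis .
qed

text \<open>The least period makes the points of the orbit distinct: a coincidence of the iterates \<open>i\<close> and
  \<open>j\<close> with \<open>i < j < l\<close> would give the smaller period \<open>l - j + i\<close>.\<close>

lemma inj_on_funpow_least_period: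
  assumes fixed: "(f ^^ l) x = x"
    and least: "\<And>m. 0 < m \<Longrightarrow> m < l \<Longrightarrow> (f ^^ m) x \<noteq> x"
  shows "inj_on (\<lambda>i. (f ^^ i) x) {..<l}"
proof (rule linorder_inj_onI)
  fix i j assume ij: "i < j" "i \<in> {..<l}" "j \<in> {..<l}"
  show "(f ^^ i) x \<noteq> (f ^^ j) x"
  proof
    assume eq: "(f ^^ i) x = (f ^^ j) x"
    have "(f ^^ (l - j + i)) x = (f ^^ (l - j)) ((f ^^ j) x)" by (simp add: funpow_add eq)
    also have "\<dots> = (f ^^ (l - j + j)) x" by (simp only: funpow_add comp_apply)
    also have "\<dots> = x" using ij fixed by simp
    finally have "(f ^^ (l - j + i)) x = x" .
    moreover have "(f ^^ (l - j + i)) x \<noteq> x" using ij by (intro least) auto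
    ultimately show False by (rule notE[rotated])
  qed
qed auto

text \<open>If the orbit does not diverge, infinitely many of its terms lie below some bound, so two of
  them agree; conversely a periodic point recurs at arbitrarily large indices.\<close>

lemma orbit_diverges_iff:
  fixes f :: "nat \<Rightarrow> nat"
  shows "filterlim (\<lambda>k. (f ^^ k) x) at_top sequentially \<longleftrightarrow>
    \<not> (\<exists>l\<ge>1. \<exists>k. (f ^^ l) ((f ^^ k) x) = (f ^^ k) x)"
proof
  assume lim: "filterlim (\<lambda>k. (f ^^ k) x) at_top sequentially"
  show "\<not> (\<exists>l\<ge>1. \<exists>k. (f ^^ l) ((f ^^ k) x) = (f ^^ k) x)"
  proof
    assume "\<exists>l\<ge>1. \<exists>k. (f ^^ l) ((f ^^ k) x) = (f ^^ k) x"
    then obtain l k where l: "l \<ge> 1" and per: "(f ^^ l) ((f ^^ k) x) = (f ^^ k) x" by blast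
    have recur: "(f ^^ (k + m * l)) x = (f ^^ k) x" for m
    proof (induction m)
      case (Suc m)
      then show ?case using funpow_periodic_shift[OF per, of "k + m * l"]
        by (simp add: add_ac)
    qed simp
    have "eventually (\<lambda>i. Suc ((f ^^ k) x) \<le> (f ^^ i) x) sequentially"
      using lim by (simp only: filterlim_at_top)
    then obtain N where N: "\<And>i. i \<ge> N \<Longrightarrow> Suc ((f ^^ k) x) \<le> (f ^^ i) x"
      by (auto simp: eventually_sequentially)
    have "N \<le> N * l" using l by simp
    then have "N \<le> k + N * l" by (rule trans_le_add2)
    then show False using N[of "k + N * l"] recur[of N] by linarith
  qed
next
  assume aper: "\<not> (\<exists>l\<ge>1. \<exists>k. (f ^^ l) ((f ^^ k) x) = (f ^^ k) x)"
  have ne: "(f ^^ i) x \<noteq> (f ^^ j) x" if "i < j" for i j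
  proof
    assume eq: "(f ^^ i) x = (f ^^ j) x"
    have "(f ^^ (j - i)) ((f ^^ i) x) = (f ^^ (j - i + i)) x" by (simp only: funpow_add comp_apply)
    also have "\<dots> = (f ^^ i) x" using that eq by simp
    finally have "(f ^^ (j - i)) ((f ^^ i) x) = (f ^^ i) x" .
    moreover have "j - i \<ge> 1" using that by simp
    ultimately show False using aper by blast
  qed
  have inj: "inj (\<lambda>k. (f ^^ k) x)"
    by (rule linorder_inj_onI) (auto dest: ne)
  show "filterlim (\<lambda>k. (f ^^ k) x) at_top sequentially"
    unfolding filterlim_at_top
  proof
    fix B
    have "finite ((\<lambda>k. (f ^^ k) x) -` {..<B})" using inj by (intro finite_vimageI) auto
    then have "finite {k. \<not> B \<le> (f ^^ k) x}" by (simp add: vimage_def not_le)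
    then show "\<forall>\<^sub>F k in sequentially. B \<le> (f ^^ k) x"
      by (simp only: cofinite_eq_sequentially[symmetric] eventually_cofinite)
  qed
qed

section \<open>Parity sequences\<close>

lemma double_collatz: "2 * collatz x = (if even x then x else 3 * x + 1)"
  by (simp add: collatz_def)

text \<open>Each step can be undone modulo one more power of two once the parity is known: an even \<open>x\<close> is
  twice its image, and for odd \<open>x\<close> twice the image is \<open>3 * x + 1\<close>, where 3 is invertible.\<close>

lemma parities_determine_start_mod:
  assumes "\<And>i. i < j \<Longrightarrow> even ((collatz ^^ i) x) = even ((collatz ^^ i) y)"
  shows "(2::int) ^ j dvd int x - int y"
  using assms
proof (induction j arbitrary: x y)
  case (Suc j)
  have par: "even x = even y" using Suc.prems[of 0] by simp
  have "even ((collatz ^^ i) (collatz x)) = even ((collatz ^^ i) (collatz y))" if "i < j" for i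
    using Suc.prems[of "Suc i"] that by (simp add: funpow_swap1)
  then have "(2::int) ^ j dvd int (collatz x) - int (collatz y)" by (rule Suc.IH)
  then have dvd: "(2::int) ^ Suc j dvd 2 * (int (collatz x) - int (collatz y))"
    unfolding power_Suc by (intro mult_dvd_mono) simp_all
  show ?case
  proof (cases "even x")
    case True
    then have "2 * (int (collatz x) - int (collatz y)) = int x - int y"
      using par double_collatz[of x] double_collatz[of y] by simp
    then show ?thesis using dvd by (simp only:)
  next
    case False
    then have "2 * (int (collatz x) - int (collatz y)) = 3 * (int x - int y)"
      using par double_collatz[of x] double_collatz[of y] by simp
    then have "(2::int) ^ Suc j dvd 3 * (int x - int y)" using dvd by (simp only:)
    moreover have "coprime ((2::int) ^ Suc j) 3" by simp
    ultimately show ?thesis by (simp only: coprime_dvd_mult_right_iff)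
  qed
qed simp

lemma parities_determine_start:
  assumes "\<And>i. even ((collatz ^^ i) x) = even ((collatz ^^ i) y)"
  shows "x = y"
proof -
  let ?d = "int x - int y"
  \<comment> \<open>Divisibility by a power of two that exceeds the difference already forces it to be 0.\<close>
  have "(2::int) ^ nat \<bar>?d\<bar> dvd ?d"
    by (rule parities_determine_start_mod) (rule assms)
  moreover have "\<bar>?d\<bar> < 2 ^ nat \<bar>?d\<bar>"
    using of_nat_less_two_power[where 'a = int, of "nat \<bar>?d\<bar>"] by simp
  ultimately show ?thesis using dvd_imp_le_int[where d = "2 ^ nat \<bar>?d\<bar>" and i = ?d] by force
qed

lemma parity_seq_eq_iff:
  "parity_seq n i = parity_seq n j \<longleftrightarrow> even (trajectory n i) = even (trajectory n j)"
  by (simp add: parity_seq_def uminus_power_if)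

text \<open>Periodicity of parities, a weak condition on each single term, is as strong as a coincidence
  of values, because the tails from \<open>k\<close> and from \<open>k + l\<close> on are trajectories with the same parities.\<close>

lemma parity_eventually_periodic_with_iff:
  "eventually_periodic_with l (parity_seq n) \<longleftrightarrow>
    l \<ge> 1 \<and> (\<exists>k. (collatz ^^ l) (trajectory n k) = trajectory n k)"
proof
  assume "eventually_periodic_with l (parity_seq n)"
  then obtain k where l: "l \<ge> 1"
    and per: "\<And>i. i \<ge> k \<Longrightarrow> parity_seq n (i + l) = parity_seq n i"
    by (auto simp: eventually_periodic_with_def)
  have "(collatz ^^ l) (trajectory n k) = trajectory n k"
  proof (rule parities_determine_start)
    fix i
    have "(collatz ^^ i) ((collatz ^^ l) (trajectory n k)) = trajectory n (i + (l + k))"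
      by (simp only: trajectory_def funpow_add comp_apply)
    moreover have "(collatz ^^ i) (trajectory n k) = trajectory n (i + k)"
      by (simp only: trajectory_def funpow_add comp_apply)
    moreover have "i + (l + k) = i + k + l" by simp
    ultimately show "even ((collatz ^^ i) ((collatz ^^ l) (trajectory n k))) =
        even ((collatz ^^ i) (trajectory n k))"
      using per[of "i + k"] by (simp only: parity_seq_eq_iff le_add2)
  qed
  then show "l \<ge> 1 \<and> (\<exists>k. (collatz ^^ l) (trajectory n k) = trajectory n k)" using l by blast
next
  assume "l \<ge> 1 \<and> (\<exists>k. (collatz ^^ l) (trajectory n k) = trajectory n k)"
  then obtain k where l: "l \<ge> 1"
    and per: "(collatz ^^ l) ((collatz ^^ k) n) = (collatz ^^ k) n"
    by (auto simp: trajectory_def)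
  have "parity_seq n (m + l) = parity_seq n m" if "m \<ge> k" for m
    using funpow_periodic_shift[OF per that] by (simp add: parity_seq_def trajectory_def)
  then show "eventually_periodic_with l (parity_seq n)"
    using l by (auto simp: eventually_periodic_with_def)
qed

section \<open>Cycles\<close>

lemma collatz_pos: "n \<ge> 1 \<Longrightarrow> collatz n \<ge> 1"
  using double_collatz[of n] by (simp split: if_splits)

lemma trajectory_pos: "n \<ge> 1 \<Longrightarrow> trajectory n k \<ge> 1"
  by (induction k) (simp_all add: trajectory_def collatz_pos del: One_nat_def)

lemma cycle_member_periodic:
  assumes "is_cycle C" "x \<in> C"
  shows "\<exists>l\<ge>1. (collatz ^^ l) x = x"
proof -
  obtain ns where ns: "ns \<noteq> []" "set ns = C"
    and step: "\<And>i. Suc i < length ns \<Longrightarrow> collatz (ns ! i) = ns ! Suc i"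
    and wrap: "collatz (last ns) = hd ns"
    using assms(1) by (auto simp: is_cycle_def)
  have nth: "(collatz ^^ i) (hd ns) = ns ! i" if "i < length ns" for i
    using that ns(1) by (induction i) (simp_all add: hd_conv_nth step)
  obtain L where L: "length ns = Suc L" using ns(1) by (cases ns) auto
  have closed: "(collatz ^^ Suc L) (hd ns) = hd ns"
    using nth[of L] wrap ns(1) L by (simp add: last_conv_nth)
  obtain i where i: "i < length ns" "x = ns ! i"
    using assms(2) ns(2) by (metis in_set_conv_nth)
  have "(collatz ^^ Suc L) x = (collatz ^^ (Suc L + i)) (hd ns)"
    by (simp only: i nth[OF i(1), symmetric] funpow_add comp_apply)
  also have "\<dots> = (collatz ^^ (i + Suc L)) (hd ns)" by (simp only: add.commute)
  also have "\<dots> = x" by (simp only: funpow_add comp_apply closed i nth)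
  finally show ?thesis by (intro exI[of _ "Suc L"]) simp
qed

text \<open>The iterates below the least period run once through the cycle; a larger period would list
  its members repeatedly.\<close>

lemma periodic_in_cycle:
  assumes "x \<ge> 1" "l \<ge> 1" "(collatz ^^ l) x = x"
  shows "\<exists>C. is_cycle C \<and> x \<in> C"
proof -
  define p where "p = (LEAST m. 0 < m \<and> (collatz ^^ m) x = x)"
  have "0 < l \<and> (collatz ^^ l) x = x" using assms by simp
  then have p: "0 < p \<and> (collatz ^^ p) x = x" unfolding p_def by (rule LeastI)
  have least: "(collatz ^^ m) x \<noteq> x" if "0 < m" "m < p" for m
    using not_less_Least[of m "\<lambda>m. 0 < m \<and> (collatz ^^ m) x = x"] that by (simp add: p_def)
  define ns where "ns = map (\<lambda>i. (collatz ^^ i) x) [0..<p]"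
  have len: "length ns = p" by (simp add: ns_def)
  have nth: "ns ! i = (collatz ^^ i) x" if "i < p" for i using that by (simp add: ns_def)
  have ne: "ns \<noteq> []" using len p by auto
  have "inj_on (\<lambda>i. (collatz ^^ i) x) {..<p}"
    using p least by (intro inj_on_funpow_least_period) auto
  then have "distinct ns" by (simp add: ns_def distinct_map atLeast0LessThan)
  moreover have "collatz (last ns) = hd ns"
  proof -
    obtain q where q: "p = Suc q" using p by (cases p) auto
    have "collatz (last ns) = (collatz ^^ p) x"
      using ne by (simp add: last_conv_nth len nth q)
    then show ?thesis using ne nth[of 0] p by (simp add: hd_conv_nth)
  qed
  moreover have "\<forall>i. Suc i < length ns \<longrightarrow> collatz (ns ! i) = ns ! Suc i"
    by (simp add: len nth)
  moreover have "0 \<notin> set ns"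
  proof
    assume "0 \<in> set ns"
    then obtain i where "(collatz ^^ i) x = 0" by (auto simp: ns_def)
    then show False using trajectory_pos[OF assms(1), of i] by (simp add: trajectory_def)
  qed
  ultimately have "is_cycle (set ns)"
    using ne unfolding is_cycle_def by (intro conjI exI[of _ ns]) simp_all
  moreover have "x \<in> set ns" using nth[of 0] nth_mem[of 0 ns] len p by simp
  ultimately show ?thesis by blast
qed

text \<open>Two even steps shrink and two odd steps enlarge; the mixed patterns give \<open>4 * x = 3 * x + 2\<close> or
  \<open>4 * x = 3 * x + 1\<close>.\<close>

lemma fixed_by_two_steps_iff:
  assumes "x \<ge> 1"
  shows "(collatz ^^ 2) x = x \<longleftrightarrow> x \<in> {1, 2}"
proof
  assume "(collatz ^^ 2) x = x"
  then have twice: "collatz (collatz x) = x" by (simp add: numeral_2_eq_2)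
  have "x = 1 \<or> x = 2"
    using double_collatz[of x] double_collatz[of "collatz x"] assms
    unfolding twice by (simp split: if_splits)
  then show "x \<in> {1, 2}" by simp
next
  assume "x \<in> {1, 2}"
  moreover have "collatz 1 = 2" "collatz 2 = 1" by (simp_all add: collatz_def)
  moreover have "(collatz ^^ 2) x = collatz (collatz x)" by (simp add: numeral_2_eq_2)
  ultimately show "(collatz ^^ 2) x = x" by auto
qed

section \<open>The three characterizations\<close>

theorem proposition7p1:
  fixes n :: nat
  assumes "n \<ge> 1"
  shows "(eventually_periodic (parity_seq n) \<longleftrightarrow>
            (\<exists>C. is_cycle C \<and> reaches (trajectory n) C)) \<and>
         (eventually_periodic_with 2 (parity_seq n) \<longleftrightarrow> reaches (trajectory n) {1, 2}) \<and>
         (\<not> eventually_periodic (parity_seq n) \<longleftrightarrow>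
            filterlim (trajectory n) at_top sequentially)"
proof (intro conjI)
  have ep: "eventually_periodic (parity_seq n) \<longleftrightarrow>
      (\<exists>l\<ge>1. \<exists>k. (collatz ^^ l) (trajectory n k) = trajectory n k)"
    by (simp add: eventually_periodic_def parity_eventually_periodic_with_iff)
  show "eventually_periodic (parity_seq n) \<longleftrightarrow> (\<exists>C. is_cycle C \<and> reaches (trajectory n) C)"
    unfolding ep reaches_def
  proof
    assume "\<exists>l\<ge>1. \<exists>k. (collatz ^^ l) (trajectory n k) = trajectory n k"
    then obtain l k where "l \<ge> 1" "(collatz ^^ l) (trajectory n k) = trajectory n k" by blast
    then show "\<exists>C. is_cycle C \<and> (\<exists>k. trajectory n k \<in> C)"
      using periodic_in_cycle[OF trajectory_pos[OF assms]] by blast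
  next
    assume "\<exists>C. is_cycle C \<and> (\<exists>k. trajectory n k \<in> C)"
    then show "\<exists>l\<ge>1. \<exists>k. (collatz ^^ l) (trajectory n k) = trajectory n k"
      using cycle_member_periodic by blast
  qed
  show "eventually_periodic_with 2 (parity_seq n) \<longleftrightarrow> reaches (trajectory n) {1, 2}"
    using fixed_by_two_steps_iff[OF trajectory_pos[OF assms]]
    by (simp add: parity_eventually_periodic_with_iff reaches_def)
  have "trajectory n = (\<lambda>k. (collatz ^^ k) n)" by (simp add: fun_eq_iff trajectory_def)
  then show "\<not> eventually_periodic (parity_seq n) \<longleftrightarrow> filterlim (trajectory n) at_top sequentially"
    unfolding ep by (simp only: orbit_diverges_iff)
qed

end
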